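(* For general contribution games with uniform budgets in which all reward functions are of the form $f_e(s_e)=h_e(\min_{u\in e}s_u(e))$ with convex $h_e$, the price of anarchy for setwise equilibria is at most $k$, where $k=\max_{e\in E}|e|$ is the size of the largest project.
   Context: General contribution game: a finite hypergraph $G=(V,E)$, where each node $v\in V$ is a player with budget $B_v\ge0$ and each hyperedge $e\in E$, $e\subseteq V$, is a joint project of a set of players. A strategy of player $v$ assigns an effort $s_v(e)\ge 0$ to each hyperedge $e\ni v$ with $\sum_{e\ni v}s_v(e)\le B_v$; a state $s=(s_v)_{v\in V}$ consists of one strategy per player. Each hyperedge has a reward function $f_e:(\mathbb{R}_{\ge0})^{|e|}\to\mathbb{R}_{\ge0}$ evaluated at $s_e=(s_u(e))_{u\in e}$; here $h_e:\mathbb{R}_{\ge0}\to\mathbb{R}_{\ge0}$ is nondecreasing. The utility of $v$ is $w_v(s)=\sum_{e\ni v}f_e(s_e)$ and the social welfare is $w(s)=\sum_{v\in V}w_v(s)$. A social optimum $s^*$ is a state maximizing $w$. Budgets are uniform if $B_u=B_v$ for all $u,v\in V$; they are then normalized to $B_v=1$. A setwise equilibrium is a state $s$ such that for every $e\in E$, every nonempty $U\subseteq e$, and every joint deviation $s'_U=(s'_u)_{u\in U}$ there is at least one player $v\in U$ with $w_v(s)\ge w_v(s'_U,s_{-U})$. The price of anarchy for setwise equilibria of a game is the ratio $w(s^* )/w(s)$ for the worst setwise equilibrium $s$ (the one of smallest welfare). *)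

theory Defs
  imports
    "HOL-Analysis.Convex"
    "HOL-Library.Extended_Real"
    "HOL-Library.FuncSet"
begin

record 'v game =
  nodes :: "'v set"
  edges :: "'v set set"
  budget :: "'v \<Rightarrow> real"
  reward :: "'v set \<Rightarrow> ('v \<Rightarrow> real) \<Rightarrow> real"

text \<open>The domain \<open>(\<real>\<^sub>\<ge>\<^sub>0)\<^bsup>|e|\<^esup>\<close> of the reward function of \<open>e\<close> is the set
  \<open>e \<rightarrow>\<^sub>E {0..}\<close> of effort vectors indexed by the members of \<open>e\<close>. Projects are nonempty, as the
  minimum over the members of a project has to exist.\<close>

definition contribution_game :: "'v game \<Rightarrow> bool" where
  "contribution_game G \<longleftrightarrow>
     finite (nodes G) \<and>
     (\<forall>e\<in>edges G. e \<subseteq> nodes G \<and> e \<noteq> {}) \<and>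
     (\<forall>v\<in>nodes G. 0 \<le> budget G v) \<and>
     (\<forall>e\<in>edges G. reward G e \<in> (e \<rightarrow>\<^sub>E {0..}) \<rightarrow> {0..})"

definition incident :: "'v game \<Rightarrow> 'v \<Rightarrow> 'v set set" where
  "incident G v = {e \<in> edges G. v \<in> e}"

text \<open>A strategy of \<open>v\<close> is a total function on sets of players; its values outside
  \<open>incident G v\<close> are unconstrained, and no utility depends on them.\<close>

definition strategy :: "'v game \<Rightarrow> 'v \<Rightarrow> ('v set \<Rightarrow> real) \<Rightarrow> bool" where
  "strategy G v x \<longleftrightarrow>
     (\<forall>e\<in>incident G v. 0 \<le> x e) \<and> (\<Sum>e\<in>incident G v. x e) \<le> budget G v"

definition state :: "'v game \<Rightarrow> ('v \<Rightarrow> 'v set \<Rightarrow> real) \<Rightarrow> bool" where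
  "state G s \<longleftrightarrow> (\<forall>v\<in>nodes G. strategy G v (s v))"

definition efforts :: "('v \<Rightarrow> 'v set \<Rightarrow> real) \<Rightarrow> 'v set \<Rightarrow> 'v \<Rightarrow> real" where
  "efforts s e = (\<lambda>u\<in>e. s u e)"

definition utility :: "'v game \<Rightarrow> 'v \<Rightarrow> ('v \<Rightarrow> 'v set \<Rightarrow> real) \<Rightarrow> real" where
  "utility G v s = (\<Sum>e\<in>incident G v. reward G e (efforts s e))"

definition welfare :: "'v game \<Rightarrow> ('v \<Rightarrow> 'v set \<Rightarrow> real) \<Rightarrow> real" where
  "welfare G s = (\<Sum>v\<in>nodes G. utility G v s)"

definition social_optimum :: "'v game \<Rightarrow> ('v \<Rightarrow> 'v set \<Rightarrow> real) \<Rightarrow> bool" where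
  "social_optimum G s \<longleftrightarrow> state G s \<and> (\<forall>s'. state G s' \<longrightarrow> welfare G s' \<le> welfare G s)"

definition setwise_equilibrium :: "'v game \<Rightarrow> ('v \<Rightarrow> 'v set \<Rightarrow> real) \<Rightarrow> bool" where
  "setwise_equilibrium G s \<longleftrightarrow> state G s \<and>
     (\<forall>e\<in>edges G. \<forall>U. U \<subseteq> e \<longrightarrow> U \<noteq> {} \<longrightarrow>
        (\<forall>s'. (\<forall>u\<in>U. strategy G u (s' u)) \<longrightarrow>
           (\<exists>v\<in>U. utility G v s \<ge> utility G v (override_on s s' U))))"

text \<open>Conventions for a vanishing denominator: \<open>0 / 0\<close> counts as \<open>1\<close> (the equilibrium is itself
  optimal), and \<open>a / 0 = \<infinity>\<close> for \<open>a > 0\<close>.\<close>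

definition welfare_ratio :: "real \<Rightarrow> real \<Rightarrow> ereal" where
  "welfare_ratio a b = (if b = 0 then (if a = 0 then 1 else \<infinity>) else ereal (a / b))"

text \<open>The ratio is largest for the equilibrium of smallest welfare, so the supremum over all
  setwise equilibria is the ratio for the worst one.\<close>

definition price_of_anarchy :: "'v game \<Rightarrow> ereal" where
  "price_of_anarchy G =
     Sup {welfare_ratio (welfare G s_opt) (welfare G s) | s_opt s.
            social_optimum G s_opt \<and> setwise_equilibrium G s}"

definition uniform_budgets :: "'v game \<Rightarrow> bool" where
  "uniform_budgets G \<longleftrightarrow> (\<forall>u\<in>nodes G. \<forall>v\<in>nodes G. budget G u = budget G v)"

definition min_convex_rewards :: "'v game \<Rightarrow> bool" where
  "min_convex_rewards G \<longleftrightarrow>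
     (\<forall>e\<in>edges G. \<exists>h :: real \<Rightarrow> real.
        h \<in> {0..} \<rightarrow> {0..} \<and> mono_on {0..} h \<and> convex_on {0..} h \<and>
        (\<forall>x \<in> e \<rightarrow>\<^sub>E {0..}. reward G e x = h (Min (x ` e))))"

end

theory Submission
  imports Defs
begin

text \<open>By convexity, raising the level of a project \<open>e\<close> from \<open>0\<close> to \<open>x\<close> gains each member at most
  the fraction \<open>x / B\<close> of the full gain \<open>h\<^sub>e(B) - h\<^sub>e(0)\<close>. In a setwise equilibrium the joint
  deviation of all members of \<open>e\<close> to full effort on \<open>e\<close> is blocked by some \<open>v \<in> e\<close>, whose
  equilibrium utility thus exceeds the utility of idling everywhere by at least the full gain
  of \<open>e\<close>. Charging \<open>e\<close> to \<open>v\<close>, each player is charged total fraction at most \<open>1\<close> because of the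
  budget, and each unit of charge pays for the at most \<open>k\<close> members of a project.\<close>

section \<open>Levels of projects and double counting\<close>

definition level :: "('v \<Rightarrow> 'v set \<Rightarrow> real) \<Rightarrow> 'v set \<Rightarrow> real" where
  "level s e = Min ((\<lambda>u. s u e) ` e)"

lemma finite_edges: "contribution_game G \<Longrightarrow> finite (edges G)"
  by (rule finite_subset[of "edges G" "Pow (nodes G)"]) (auto simp: contribution_game_def)

lemma finite_edge: "contribution_game G \<Longrightarrow> e \<in> edges G \<Longrightarrow> finite e"
  by (auto simp: contribution_game_def intro: finite_subset)

lemma state_effort_nonneg:
  assumes "contribution_game G" "state G s" "e \<in> edges G" "u \<in> e"
  shows "0 \<le> s u e"
proof -
  have "u \<in> nodes G"
    using assms by (auto simp: contribution_game_def)
  then have "strategy G u (s u)"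
    using assms(2) by (simp add: state_def)
  then show ?thesis
    using assms(3,4) by (simp add: strategy_def incident_def)
qed

lemma level_le:
  assumes "contribution_game G" "e \<in> edges G" "u \<in> e"
  shows "level s e \<le> s u e"
  unfolding level_def using finite_edge[OF assms(1,2)] assms(3) by (simp add: Min_le)

lemma level_nonneg:
  assumes "contribution_game G" "state G s" "e \<in> edges G"
  shows "0 \<le> level s e"
proof -
  have "e \<noteq> {}"
    using assms by (auto simp: contribution_game_def)
  then show ?thesis
    unfolding level_def using finite_edge[OF assms(1,3)] state_effort_nonneg[OF assms] by simp
qed

text \<open>A level is at most the effort of \<open>v\<close> itself, so all projects of one player
  share that player's budget. This later bounds the total fraction charged to a player.\<close>

lemma sum_level_le_budget:
  assumes "contribution_game G" "state G s" "v \<in> nodes G"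
  shows "(\<Sum>e\<in>incident G v. level s e) \<le> budget G v"
proof -
  have "(\<Sum>e\<in>incident G v. level s e) \<le> (\<Sum>e\<in>incident G v. s v e)"
    by (intro sum_mono level_le[OF assms(1)]) (auto simp: incident_def)
  also have "\<dots> \<le> budget G v"
    using assms(2,3) by (simp add: state_def strategy_def)
  finally show ?thesis .
qed

text \<open>Double counting: a project appears once for each of its members. This brings in the
  project sizes, hence the factor \<open>k\<close>.\<close>

lemma sum_incident_swap:
  fixes f :: "'v set \<Rightarrow> real"
  assumes "contribution_game G"
  shows "(\<Sum>v\<in>nodes G. \<Sum>e\<in>incident G v. f e) = (\<Sum>e\<in>edges G. real (card e) * f e)"
proof -
  have "(\<Sum>v\<in>nodes G. \<Sum>e\<in>incident G v. f e) = (\<Sum>e\<in>edges G. \<Sum>v | v \<in> nodes G \<and> v \<in> e. f e)"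
    unfolding incident_def
    by (rule sum.swap_restrict) (use assms finite_edges in \<open>auto simp: contribution_game_def\<close>)
  also have "\<dots> = (\<Sum>e\<in>edges G. real (card e) * f e)"
  proof (rule sum.cong[OF refl])
    fix e assume "e \<in> edges G"
    then have "{v. v \<in> nodes G \<and> v \<in> e} = e"
      using assms by (auto simp: contribution_game_def)
    then show "(\<Sum>v | v \<in> nodes G \<and> v \<in> e. f e) = real (card e) * f e" by simp
  qed
  finally show ?thesis .
qed

lemma convex_on_le_chord:
  fixes h :: "real \<Rightarrow> real"
  assumes "convex_on {0..} h" "0 \<le> x" "x \<le> B"
  shows "h x \<le> h 0 + x / B * (h B - h 0)"
\<comment> \<open>\<open>B = 0\<close> forces \<open>x = 0\<close>, and since
  \<open>x / 0 = 0\<close> the bound reads \<open>h 0 \<le> h 0\<close>. Zero budgets thus need no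
  separate treatment later.\<close>
proof (cases "B = 0")
  case False
  with assms have B: "0 < B" by simp
  have "h ((1 - x / B) *\<^sub>R 0 + (x / B) *\<^sub>R B) \<le> (1 - x / B) * h 0 + x / B * h B"
    by (rule convex_onD[OF assms(1)]) (use assms B in \<open>auto simp: field_simps\<close>)
  then show ?thesis using B by (simp add: algebra_simps)
qed (use assms in simp)

section \<open>Games with a common budget whose rewards depend only on the level\<close>

locale min_reward_game =
  fixes G :: "'v game" and B :: real and h :: "'v set \<Rightarrow> real \<Rightarrow> real"
  assumes game: "contribution_game G"
    and budget: "v \<in> nodes G \<Longrightarrow> budget G v = B"
    and B_nonneg: "0 \<le> B"
    and h_nonneg: "e \<in> edges G \<Longrightarrow> 0 \<le> x \<Longrightarrow> 0 \<le> h e x"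
    and h_mono: "e \<in> edges G \<Longrightarrow> mono_on {0..} (h e)"
    and h_convex: "e \<in> edges G \<Longrightarrow> convex_on {0..} (h e)"
    and reward: "e \<in> edges G \<Longrightarrow> y \<in> e \<rightarrow>\<^sub>E {0..} \<Longrightarrow> reward G e y = h e (Min (y ` e))"
begin

text \<open>The baseline that \<open>v\<close> keeps when all projects have level 0; it can be
  positive, as \<open>h e 0\<close> need not vanish.\<close>

definition idle_utility :: "'v \<Rightarrow> real" where
  "idle_utility v = (\<Sum>e\<in>incident G v. h e 0)"

lemma finite_incident: "finite (incident G v)"
  using finite_edges[OF game] by (simp add: incident_def)

lemma utility_eq:
  assumes "state G s"
  shows "utility G v s = (\<Sum>e\<in>incident G v. h e (level s e))"
  unfolding utility_def
proof (rule sum.cong[OF refl])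
  fix e assume "e \<in> incident G v"
  then have e: "e \<in> edges G" by (simp add: incident_def)
  have "efforts s e \<in> e \<rightarrow>\<^sub>E {0..}"
    using state_effort_nonneg[OF game assms e] by (auto simp: efforts_def)
  moreover have "efforts s e ` e = (\<lambda>u. s u e) ` e"
    by (auto simp: efforts_def)
  ultimately show "reward G e (efforts s e) = h e (level s e)"
    using reward[OF e] by (simp add: level_def)
qed

lemma h_mono_le: "e \<in> edges G \<Longrightarrow> 0 \<le> x \<Longrightarrow> x \<le> y \<Longrightarrow> h e x \<le> h e y"
  using h_mono by (auto simp: mono_on_def)

lemma idle_utility_nonneg: "0 \<le> idle_utility v"
  unfolding idle_utility_def by (intro sum_nonneg h_nonneg) (auto simp: incident_def)

lemma idle_utility_le:
  assumes "state G s"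
  shows "idle_utility v \<le> utility G v s"
  unfolding utility_eq[OF assms] idle_utility_def
  by (intro sum_mono h_mono_le level_nonneg[OF game assms]) (auto simp: incident_def)

lemma welfare_nonneg: "state G s \<Longrightarrow> 0 \<le> welfare G s"
  unfolding welfare_def by (meson idle_utility_le idle_utility_nonneg order_trans sum_nonneg)

lemma welfare_le_gains:
  assumes "state G s"
  shows "welfare G s \<le> (\<Sum>v\<in>nodes G. idle_utility v) +
    (\<Sum>e\<in>edges G. real (card e) * (level s e / B * (h e B - h e 0)))"
proof -
  have "utility G v s \<le> idle_utility v + (\<Sum>e\<in>incident G v. level s e / B * (h e B - h e 0))"
    for v
    unfolding utility_eq[OF assms] idle_utility_def sum.distrib[symmetric]
  proof (rule sum_mono)
    fix e assume "e \<in> incident G v"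
    then have e: "e \<in> edges G" and "v \<in> e" by (auto simp: incident_def)
    then have v: "v \<in> nodes G" using game by (auto simp: contribution_game_def)
    \<comment> \<open>The chord bound requires the level to lie below \<open>B\<close>; any member
      \<open>v\<close> of \<open>e\<close> provides this through its budget.\<close>
    have "level s e \<le> (\<Sum>e\<in>incident G v. level s e)"
      by (rule member_le_sum[OF \<open>e \<in> incident G v\<close>])
        (auto simp: incident_def finite_edges[OF game] level_nonneg[OF game assms])
    also have "\<dots> \<le> B"
      using sum_level_le_budget[OF game assms v] budget[OF v] by simp
    finally show "h e (level s e) \<le> h e 0 + level s e / B * (h e B - h e 0)"
      using convex_on_le_chord[OF h_convex[OF e] level_nonneg[OF game assms e]] by simp
  qed
  then have "welfare G s \<le> (\<Sum>v\<in>nodes G. idle_utility v +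
      (\<Sum>e\<in>incident G v. level s e / B * (h e B - h e 0)))"
    unfolding welfare_def by (rule sum_mono)
  then show ?thesis
    by (simp add: sum.distrib sum_incident_swap[OF game])
qed

lemma equilibrium_blocking_player:
  assumes s: "setwise_equilibrium G s" and e: "e \<in> edges G"
  shows "\<exists>v\<in>e. h e B - h e 0 \<le> utility G v s - idle_utility v"
proof -
  \<comment> \<open>All members of \<open>e\<close> jointly move their whole budget to
    \<open>e\<close>, that is, the deviating set \<open>U\<close> is \<open>e\<close>
    itself.\<close>
  define d where "d = (\<lambda>(u :: 'v) e'. if e' = e then B else 0)"
  define t where "t = override_on s d e"
  have nodes: "e \<subseteq> nodes G" and "e \<noteq> {}"
    using game e by (auto simp: contribution_game_def)
  have d: "strategy G u (d u)" if "u \<in> e" for u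
  proof -
    have "e \<in> incident G u" using that e by (simp add: incident_def)
    then show ?thesis
      using B_nonneg budget that nodes finite_incident
      by (auto simp: strategy_def d_def sum.delta)
  qed
  have state: "state G t"
    using s d unfolding t_def setwise_equilibrium_def state_def
    by (simp add: override_on_def)
  obtain v where v: "v \<in> e" and "utility G v t \<le> utility G v s"
    using s d e \<open>e \<noteq> {}\<close> unfolding t_def setwise_equilibrium_def by blast
  moreover have "utility G v t = idle_utility v + (h e B - h e 0)"
  proof -
    have "level t e' = (if e' = e then B else 0)" if "e' \<in> incident G v" for e'
    proof (cases "e' = e")
      case True
      have "(\<lambda>u. t u e) ` e = {B}"
        using v by (auto simp: t_def d_def)
      then show ?thesis using True by (simp add: level_def)
    next
      case False
      from that have e': "e' \<in> edges G" "v \<in> e'" by (auto simp: incident_def)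
      \<comment> \<open>The blocking player contributes nothing to \<open>e'\<close>, which pins the
        minimum to 0 whatever the other members do. Hence its utility after the deviation is exactly
        the idle utility plus the full gain of \<open>e\<close>.\<close>
      have "level t e' \<le> 0"
        using level_le[OF game e', of t] v False by (simp add: t_def d_def)
      then show ?thesis using level_nonneg[OF game state e'(1)] False by simp
    qed
    then have "utility G v t =
        (\<Sum>e'\<in>incident G v. h e' 0 + (if e' = e then h e B - h e 0 else 0))"
      unfolding utility_eq[OF state] by (intro sum.cong) auto
    moreover have "e \<in> incident G v"
      using v e by (simp add: incident_def)
    ultimately show ?thesis
      by (simp add: sum.distrib idle_utility_def finite_incident)
  qed
  ultimately show ?thesis by (intro bexI[of _ v]) auto
qed

lemma welfare_le_equilibrium:
  assumes s: "state G s" and eq: "setwise_equilibrium G t"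
    and card: "\<And>e. e \<in> edges G \<Longrightarrow> card e \<le> k" and k: "1 \<le> k"
  shows "welfare G s \<le> real k * welfare G t"
proof -
  define W where "W v = utility G v t - idle_utility v" for v
  have t: "state G t" using eq by (simp add: setwise_equilibrium_def)
  have W: "0 \<le> W v" for v
    using idle_utility_le[OF t] by (simp add: W_def)
  \<comment> \<open>\<open>p e\<close> is the blocking player to whom project \<open>e\<close> is
    charged.\<close>
  obtain p where p: "\<And>e. e \<in> edges G \<Longrightarrow> p e \<in> e \<and> h e B - h e 0 \<le> W (p e)"
    using equilibrium_blocking_player[OF eq] unfolding W_def by metis
  have frac: "0 \<le> level s e / B" if "e \<in> edges G" for e
    using level_nonneg[OF game s that] B_nonneg by simp
  have gains: "(\<Sum>e\<in>edges G. real (card e) * (level s e / B * (h e B - h e 0)))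
      \<le> (\<Sum>e\<in>edges G. real k * (level s e / B * W (p e)))"
  proof (rule sum_mono)
    fix e assume e: "e \<in> edges G"
    have le: "level s e / B * (h e B - h e 0) \<le> level s e / B * W (p e)"
      using p[OF e] frac[OF e] by (intro mult_left_mono) auto
    \<comment> \<open>Nonnegativity of the gain allows \<open>card e\<close> to be replaced by the
      larger \<open>k\<close>.\<close>
    have gain: "0 \<le> level s e / B * (h e B - h e 0)"
      using frac[OF e] h_mono_le[OF e order_refl B_nonneg] by (intro mult_nonneg_nonneg) auto
    show "real (card e) * (level s e / B * (h e B - h e 0))
        \<le> real k * (level s e / B * W (p e))"
      by (rule mult_mono[OF _ le _ gain]) (use card[OF e] in simp_all)
  qed
  \<comment> \<open>Collect the charges by the player who bears them.\<close>
  have "(\<Sum>e\<in>edges G. level s e / B * W (p e))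
      = (\<Sum>v\<in>nodes G. \<Sum>e | e \<in> edges G \<and> p e = v. level s e / B * W (p e))"
  proof (rule sum.group[symmetric])
    show "finite (edges G)" "finite (nodes G)"
      using game finite_edges[OF game] by (auto simp: contribution_game_def)
    show "p ` edges G \<subseteq> nodes G"
      using game p by (auto simp: contribution_game_def)
  qed
  also have "\<dots> \<le> (\<Sum>v\<in>nodes G. W v)"
  proof (rule sum_mono)
    fix v assume v: "v \<in> nodes G"
    \<comment> \<open>Since \<open>p e \<in> e\<close>, projects charged to \<open>v\<close> are
      among those incident to \<open>v\<close>, so the budget of \<open>v\<close> limits their
      levels in \<open>s\<close>.\<close>
    have "(\<Sum>e | e \<in> edges G \<and> p e = v. level s e / B)
        \<le> (\<Sum>e\<in>incident G v. level s e / B)"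
      by (rule sum_mono2) (use finite_incident p frac in \<open>auto simp: incident_def\<close>)
    also have "\<dots> \<le> B / B"
      using sum_level_le_budget[OF game s v] budget[OF v] B_nonneg
      by (simp add: sum_divide_distrib[symmetric] divide_right_mono)
    \<comment> \<open>The quotient is 1, or 0 if \<open>B = 0\<close>.\<close>
    also have "\<dots> \<le> 1" by simp
    finally have "(\<Sum>e | e \<in> edges G \<and> p e = v. level s e / B) * W v \<le> 1 * W v"
      using W by (rule mult_right_mono)
    then show "(\<Sum>e | e \<in> edges G \<and> p e = v. level s e / B * W (p e)) \<le> W v"
      by (simp add: sum_distrib_right)
  qed
  finally have "real k * (\<Sum>e\<in>edges G. level s e / B * W (p e))
      \<le> real k * (\<Sum>v\<in>nodes G. W v)"
    by (rule mult_left_mono) simp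
  with gains have gains_le: "(\<Sum>e\<in>edges G. real (card e) * (level s e / B * (h e B - h e 0)))
      \<le> real k * (\<Sum>v\<in>nodes G. W v)"
    unfolding sum_distrib_left by (rule order_trans)
  have welfare_t: "welfare G t = (\<Sum>v\<in>nodes G. idle_utility v) + (\<Sum>v\<in>nodes G. W v)"
    by (simp add: welfare_def W_def sum_subtractf)
  \<comment> \<open>The idle parts agree in \<open>s\<close> and \<open>t\<close>; they are inflated
    by \<open>k \<ge> 1\<close> only to match the factor on the gains.\<close>
  have idle_le: "(\<Sum>v\<in>nodes G. idle_utility v) \<le> real k * (\<Sum>v\<in>nodes G. idle_utility v)"
    using mult_right_mono[of 1 "real k" "\<Sum>v\<in>nodes G. idle_utility v"] k
    by (simp add: sum_nonneg idle_utility_nonneg)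
  show ?thesis
    unfolding welfare_t distrib_left
    by (rule order_trans[OF welfare_le_gains[OF s] add_mono[OF idle_le gains_le]])
qed

end

section \<open>From the game to the price of anarchy\<close>

lemma min_reward_game_exists:
  assumes "contribution_game G" "edges G \<noteq> {}" "uniform_budgets G" "min_convex_rewards G"
  obtains B h where "min_reward_game G B h"
proof -
  \<comment> \<open>Some project exists and is nonempty, so there is a player whose budget can serve
    as \<open>B\<close>.\<close>
  obtain v where v: "v \<in> nodes G"
    using assms(1,2) unfolding contribution_game_def by blast
  obtain h :: "'a set \<Rightarrow> real \<Rightarrow> real" where h: "\<forall>e\<in>edges G.
      h e \<in> {0..} \<rightarrow> {0..} \<and> mono_on {0..} (h e) \<and> convex_on {0..} (h e) \<and>
      (\<forall>x \<in> e \<rightarrow>\<^sub>E {0..}. reward G e x = h e (Min (x ` e)))"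
    using bchoice[OF assms(4)[unfolded min_convex_rewards_def]] by blast
  have "min_reward_game G (budget G v) h"
  proof
    show "budget G u = budget G v" if "u \<in> nodes G" for u
      using that v assms(3) unfolding uniform_budgets_def by blast
    show "0 \<le> budget G v"
      using v assms(1) unfolding contribution_game_def by blast
    show "0 \<le> h e x" if "e \<in> edges G" "0 \<le> x" for e x
      using h that by (auto simp: Pi_iff)
  qed (use assms(1) h in simp_all)
  then show thesis by (rule that)
qed

theorem corollary8p4:
  fixes G :: "'v game" and k :: nat
  assumes "contribution_game G"
    and "edges G \<noteq> {}"
    and "uniform_budgets G"
    and "min_convex_rewards G"
    and "k = Max (card ` edges G)"
  shows "price_of_anarchy G \<le> ereal (real k)"
proof -
  obtain B h where "min_reward_game G B h"
    using min_reward_game_exists[OF assms(1-4)] by blast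
  then interpret min_reward_game G B h .
  have card: "card e \<le> k" if "e \<in> edges G" for e
    using that assms(5) finite_edges[OF game] by simp
  obtain e where e: "e \<in> edges G" using assms(2) by blast
  then have "card e \<noteq> 0"
    using finite_edge[OF game e] game by (auto simp: contribution_game_def)
  then have k: "1 \<le> k" using card[OF e] by simp
  show ?thesis
    unfolding price_of_anarchy_def
  proof (rule Sup_least, clarify)
    fix s t assume "social_optimum G s" and eq: "setwise_equilibrium G t"
    then have s: "state G s" and t: "state G t"
      by (auto simp: social_optimum_def setwise_equilibrium_def)
    have "welfare G s \<le> real k * welfare G t"
      using welfare_le_equilibrium[OF s eq card k] .
    \<comment> \<open>If \<open>welfare G t = 0\<close>, the bound and nonnegativity give
      \<open>welfare G s = 0\<close>; the ratio is then 1 by convention, and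
      \<open>1 \<le> k\<close>.\<close>
    then show "welfare_ratio (welfare G s) (welfare G t) \<le> ereal (real k)"
      using welfare_nonneg[OF s] welfare_nonneg[OF t] k
      by (auto simp: welfare_ratio_def divide_le_eq)
  qed
qed

end
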